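(* Let $A_1,A_2\in\mathbf{C}^{n\times n}$, $F_1,F_2\in\mathbf{C}^{p\times p}$ and $C_1,C_2\in\mathbf{C}^{n\times p}$, and assume that $$\mu\{A_1,A_2\}+\mu\{F_1,F_2\}<0.$$ Then the Sylvester bimatrix equation $$\{A_1,A_2\}\{X_1,X_2\}-\{X_1,X_2\}\{F_1,F_2\}=\{C_1,C_2\}$$ has a unique solution given by $$\{X_1,X_2\}=\int_0^\infty \mathrm{e}^{t\{A_1,A_2\}}\{C_1,C_2\}\mathrm{e}^{t\{F_1,F_2\}}\,\mathrm{d}t.$$ Particularly, if the continuous-time complex-valued linear system $\dot x=\{A_1,A_2\}x+\{B_1,B_2\}u$ is asymptotically stable, then the solution to the Lyapunov bimatrix equation $$\{A_1,A_2\}^{\mathrm{H}}\{P_1,P_2\}+\{P_1,P_2\}\{A_1,A_2\}=-\{Q_1,Q_2\},$$ where $\{Q_1,Q_2\}>0$ is given, is given by $$\{P_1,P_2\}=\int_0^\infty \mathrm{e}^{t\{A_1,A_2\}^{\mathrm{H}}}\{Q_1,Q_2\}\mathrm{e}^{t\{A_1,A_2\}}\,\mathrm{d}t.$$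
   Context: $A^{\#}$, $A^{\mathrm T}$, $A^{\mathrm H}$ denote the conjugate, transpose and conjugate transpose of $A$. A bimatrix $\{A_1,A_2\}\in\{\mathbf{C}^{n\times m},\mathbf{C}^{n\times m}\}$ is a pair of matrices of the same size, identified with the real-linear map $x\mapsto A_1x+A_2^{\#}x^{\#}$. Addition and multiplication by real scalars (hence integrals over real $t$) are componentwise, and the product corresponds to composition: $\{A_1,A_2\}\{X_1,X_2\}=\{A_1X_1+A_2^{\#}X_2,\;A_1^{\#}X_2+A_2X_1\}$. The exponential of a square bimatrix is defined by the usual power series, with identity $\{I_n,0_{n\times n}\}$. The complex lifting is $\{P_1,P_2\}_\diamond=\begin{bmatrix}P_1&P_2^{\#}\\P_2&P_1^{\#}\end{bmatrix}$ and is multiplicative; eigenvalues of a square bimatrix are those of its lifting, and $\mu\{P_1,P_2\}$ is the spectral abscissa, i.e. the maximal real part of the eigenvalues. The conjugate transpose $\{A_1,A_2\}^{\mathrm H}=\{A_1^{\mathrm H},A_2^{\mathrm T}\}$ is the bimatrix whose lifting is $(\{A_1,A_2\}_\diamond)^{\mathrm H}$. $\{Q_1,Q_2\}>0$ (with $Q_1,Q_2\in\mathbf{C}^{n\times n}$) means that $\{Q_1,Q_2\}_\diamond$ is Hermitian positive definite. Here $B_1,B_2\in\mathbf{C}^{n\times m}$ and $u$ is the control; asymptotic stability of the system refers to $\dot x=\{A_1,A_2\}x$ (zero control).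
   Formalization: The Sylvester equation AX − XF = C is corrected to AX + XF = −C; as printed the claim is false (scalar A = −1, F = 0, C = 1: the integral is 1, but AX − XF = −1). The hypothesis, the integral formula and the Lyapunov part are unchanged. *)

theory Defs
  imports "HOL-Analysis.Analysis"
begin

text \<open>
  A bimatrix is a pair of complex matrices of equal size.  Addition, negation, real scaling, the
  topology, series and integrals are those of the library's product type.
\<close>

type_synonym ('m, 'n) bimatrix = "(complex^'m^'n) \<times> (complex^'m^'n)"

definition cnj_vec :: "complex^'n \<Rightarrow> complex^'n"
  where "cnj_vec x = (\<chi> i. cnj (x $ i))"

abbreviation cnj_mat :: "complex^'m^'n \<Rightarrow> complex^'m^'n"
  where "cnj_mat \<equiv> map_matrix cnj"

definition herm_mat :: "complex^'m^'n \<Rightarrow> complex^'n^'m"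
  where "herm_mat A = transpose (cnj_mat A)"

fun bi_apply :: "('m::finite, 'n::finite) bimatrix \<Rightarrow> complex^'m \<Rightarrow> complex^'n"
  where "bi_apply (A1, A2) x = A1 *v x + cnj_mat A2 *v cnj_vec x"

fun bi_mult :: "('m::finite, 'n::finite) bimatrix \<Rightarrow> ('k::finite, 'm) bimatrix \<Rightarrow> ('k, 'n) bimatrix"
    (infixl \<open>**\<^sub>b\<close> 70)
  where "(A1, A2) **\<^sub>b (X1, X2) = (A1 ** X1 + cnj_mat A2 ** X2, cnj_mat A1 ** X2 + A2 ** X1)"

definition bi_id :: "('n::finite, 'n) bimatrix"
  where "bi_id = (mat 1, 0)"

fun bi_herm :: "('m::finite, 'n::finite) bimatrix \<Rightarrow> ('n, 'm) bimatrix"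
  where "bi_herm (A1, A2) = (herm_mat A1, transpose A2)"

fun bi_power :: "('n::finite, 'n) bimatrix \<Rightarrow> nat \<Rightarrow> ('n, 'n) bimatrix"
  where
    "bi_power A 0 = bi_id"
  | "bi_power A (Suc k) = A **\<^sub>b bi_power A k"

definition bi_exp :: "('n::finite, 'n) bimatrix \<Rightarrow> ('n, 'n) bimatrix"
  where "bi_exp A = (\<Sum>k. bi_power A k /\<^sub>R fact k)"

fun lifting :: "('m::finite, 'n::finite) bimatrix \<Rightarrow> complex^('m + 'm)^('n + 'n)"
  where "lifting (P1, P2) =
    (\<chi> i j. case (i, j) of
        (Inl a, Inl b) \<Rightarrow> P1 $ a $ b
      | (Inl a, Inr b) \<Rightarrow> cnj (P2 $ a $ b)
      | (Inr a, Inl b) \<Rightarrow> P2 $ a $ b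
      | (Inr a, Inr b) \<Rightarrow> cnj (P1 $ a $ b))"

definition eigenvalues :: "complex^'n^'n \<Rightarrow> complex set"
  where "eigenvalues M = {l. \<exists>v. v \<noteq> 0 \<and> M *v v = l *s v}"

definition spectral_abscissa :: "('n::finite, 'n) bimatrix \<Rightarrow> real"
  where "spectral_abscissa A = Max (Re ` eigenvalues (lifting A))"

text \<open>
  For Hermitian \<open>M\<close> the form below is real, so that \<open>Re\<close> only changes its type.
\<close>

definition hermitian_pos_def :: "complex^'n^'n \<Rightarrow> bool"
  where "hermitian_pos_def M \<longleftrightarrow> herm_mat M = M \<and>
    (\<forall>v. v \<noteq> 0 \<longrightarrow> 0 < Re (\<Sum>i\<in>UNIV. cnj (v $ i) * (M *v v) $ i))"

definition bi_pos_def :: "('n::finite, 'n) bimatrix \<Rightarrow> bool"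
  where "bi_pos_def Q \<longleftrightarrow> hermitian_pos_def (lifting Q)"

definition is_trajectory ::
    "('n::finite, 'n) bimatrix \<Rightarrow> ('m::finite, 'n) bimatrix \<Rightarrow> (real \<Rightarrow> complex^'m) \<Rightarrow>
      (real \<Rightarrow> complex^'n) \<Rightarrow> bool"
  where "is_trajectory A B u x \<longleftrightarrow>
    (\<forall>t\<ge>0. (x has_vector_derivative bi_apply A (x t) + bi_apply B (u t)) (at t within {0..}))"

text \<open>
  Stability in the sense of Lyapunov together with attractivity of the origin, for the zero control.
\<close>

definition asymptotically_stable ::
    "('n::finite, 'n) bimatrix \<Rightarrow> ('m::finite, 'n) bimatrix \<Rightarrow> bool"
  where "asymptotically_stable A B \<longleftrightarrow>
    (\<forall>e>0. \<exists>d>0. \<forall>x. is_trajectory A B (\<lambda>_. 0) x \<and> norm (x 0) < d \<longrightarrow> (\<forall>t\<ge>0. norm (x t) < e)) \<and>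
    (\<exists>d>0. \<forall>x. is_trajectory A B (\<lambda>_. 0) x \<and> norm (x 0) < d \<longrightarrow> (x \<longlongrightarrow> 0) at_top)"


lemma cnj_mat_mult: "cnj_mat (A ** B) = cnj_mat A ** cnj_mat B"
  by (simp add: vec_eq_iff matrix_matrix_mult_def)

lemma cnj_mat_add: "cnj_mat (A + B) = cnj_mat A + cnj_mat B"
  by (simp add: vec_eq_iff)

lemma cnj_mat_cnj_mat: "cnj_mat (cnj_mat A) = A"
  by (simp add: vec_eq_iff)

lemma cnj_vec_mult: "cnj_vec (A *v x) = cnj_mat A *v cnj_vec x"
  by (simp add: vec_eq_iff cnj_vec_def matrix_vector_mult_def)

lemma cnj_vec_add: "cnj_vec (x + y) = cnj_vec x + cnj_vec y"
  by (simp add: vec_eq_iff cnj_vec_def)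

lemma cnj_vec_cnj_vec: "cnj_vec (cnj_vec x) = x"
  by (simp add: vec_eq_iff cnj_vec_def)

lemma bi_apply_mult: "bi_apply (A **\<^sub>b X) x = bi_apply A (bi_apply X x)"
  by (cases A; cases X)
    (simp add: cnj_mat_mult cnj_mat_add cnj_mat_cnj_mat cnj_vec_mult cnj_vec_add cnj_vec_cnj_vec
      matrix_vector_mul_assoc matrix_vector_mult_add_rdistrib matrix_vector_right_distrib algebra_simps)

lemma sum_UNIV_Plus: "(\<Sum>i\<in>UNIV. f i) = (\<Sum>i\<in>UNIV. f (Inl i)) + (\<Sum>i\<in>UNIV. f (Inr i))"
  for f :: "'a::finite + 'b::finite \<Rightarrow> complex"
  by (simp add: UNIV_Plus_UNIV[symmetric] sum.Plus del: UNIV_Plus_UNIV)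

lemma lifting_mult: "lifting (A **\<^sub>b X) = lifting A ** lifting X"
  by (cases A; cases X)
    (simp add: vec_eq_iff matrix_matrix_mult_def sum_UNIV_Plus split: sum.split)

lemma lifting_id: "lifting bi_id = mat 1"
  by (simp add: vec_eq_iff bi_id_def mat_def split: sum.split)

lemma lifting_herm: "lifting (bi_herm A) = herm_mat (lifting A)"
  by (cases A) (simp add: vec_eq_iff herm_mat_def transpose_def split: sum.split)

lemma cnj_mat_scaleR: "cnj_mat (r *\<^sub>R A) = r *\<^sub>R cnj_mat A"
  by (simp add: vec_eq_iff)

lemma matrix_scaleR_left: "(r *\<^sub>R A) ** B = r *\<^sub>R (A ** B)" for A :: "complex^'m^'n"
  by (simp add: vec_eq_iff matrix_matrix_mult_def scaleR_sum_right)

lemma matrix_scaleR_right: "A ** (r *\<^sub>R B) = r *\<^sub>R (A ** B)" for A :: "complex^'m^'n"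
  by (simp add: vec_eq_iff matrix_matrix_mult_def scaleR_sum_right)

lemma matrix_add_left: "(A + B) ** C = A ** C + B ** C" for A :: "complex^'m^'n"
  by (simp add: vec_eq_iff matrix_matrix_mult_def sum.distrib algebra_simps)

lemma bounded_bilinear_bi_mult: "bounded_bilinear (**\<^sub>b)"
proof -
  have "bilinear ((**\<^sub>b) :: ('m::finite, 'n::finite) bimatrix \<Rightarrow> ('k::finite, 'm) bimatrix \<Rightarrow> _)"
    unfolding bilinear_def
    by (auto intro!: linearI simp: cnj_mat_add cnj_mat_scaleR matrix_scaleR_left
        matrix_scaleR_right matrix_add_left matrix_add_ldistrib scaleR_add_right)
  then show ?thesis
    by (simp add: bilinear_conv_bounded_bilinear)
qed

lemma summable_bi_exp:
  fixes A :: "('a::finite, 'a) bimatrix"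
  shows "summable (\<lambda>k. bi_power A k /\<^sub>R fact k)"
proof -
  obtain K where K: "0 \<le> K" "\<And>X :: ('a, 'a) bimatrix. norm (A **\<^sub>b X) \<le> norm X * K"
    using bounded_linear.nonneg_bounded[OF bounded_bilinear.bounded_linear_right[OF bounded_bilinear_bi_mult]]
    by blast
  have "norm (bi_power A k) \<le> norm (bi_id :: ('a, 'a) bimatrix) * K ^ k" for k
  proof (induction k)
    case (Suc k)
    have "norm (bi_power A (Suc k)) \<le> norm (bi_power A k) * K"
      using K by simp
    also have "\<dots> \<le> norm (bi_id :: ('a, 'a) bimatrix) * K ^ k * K"
      using Suc K by (simp add: mult_right_mono)
    finally show ?case by (simp add: mult_ac)
  qed simp
  then have bnd: "norm (bi_power A k /\<^sub>R fact k) \<le> norm (bi_id :: ('a, 'a) bimatrix) * (K ^ k /\<^sub>R fact k)" for k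
    by (simp add: divide_simps)
  show ?thesis
    by (rule summable_comparison_test'[OF summable_mult[OF summable_exp_generic[of K]] bnd])
qed

end

theory Submission
  imports Defs "HOL-Computational_Algebra.Fundamental_Theorem_Algebra"
begin

text \<open>
  By the fundamental theorem of algebra, a matrix \<open>M\<close> is annihilated by a product of factors
  \<open>M - l\<close> with eigenvalues \<open>l\<close>; peeling off one factor at a time reduces the growth of solutions of
  \<open>Y' = M Y\<close> to scalar equations \<open>u' = l u + w\<close>, so that \<open>e\<^sup>t\<^sup>M\<close> is of order \<open>e\<^sup>b\<^sup>t\<close> whenever \<open>b\<close>
  exceeds all real parts of eigenvalues. Along \<open>f(t) = e\<^sup>t\<^sup>A C e\<^sup>t\<^sup>F\<close> one has \<open>f' = A f + f F\<close>;
  integrating over \<open>[0, \<infinity>)\<close> gives the solution. If \<open>A X + X F = 0\<close>, then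
  \<open>e\<^sup>t\<^sup>A X e\<^sup>t\<^sup>F\<close> is constant and tends to zero, hence \<open>X = 0\<close>. For the Lyapunov equation, an
  eigenvalue of nonnegative real part yields trajectories that do not tend to zero.
\<close>

section \<open>Complex matrices and polynomials evaluated at a matrix\<close>

lemma mat_mult_component: "(mat c ** X) $ i $ j = c * X $ i $ j" for X :: "complex^'m^'n"
  by (simp add: matrix_matrix_mult_def mat_def if_distrib [of "\<lambda>x. x * _"] cong: if_cong)

lemma matrix_diff_left: "(A - B) ** C = A ** C - B ** C" for A :: "complex^'m^'n"
  by (simp add: vec_eq_iff matrix_matrix_mult_def sum_subtractf algebra_simps)

lemma matrix_diff_right: "A ** (B - C) = A ** B - A ** C" for A :: "complex^'m^'n"
  by (simp add: vec_eq_iff matrix_matrix_mult_def sum_subtractf algebra_simps)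

lemma matrix_zero_left [simp]: "0 ** C = (0 :: complex^'k^'n)" for C :: "complex^'k^'m"
  by (simp add: vec_eq_iff matrix_matrix_mult_def)

lemma matrix_zero_right [simp]: "A ** 0 = (0 :: complex^'k^'n)" for A :: "complex^'m^'n"
  by (simp add: vec_eq_iff matrix_matrix_mult_def)

lemma matrix_sum_right: "A ** sum f S = (\<Sum>i\<in>S. A ** f i)" for A :: "complex^'m^'n"
  by (induction S rule: infinite_finite_induct) (simp_all add: matrix_add_ldistrib)

lemma mat_add: "mat (a + b) = mat a + (mat b :: complex^'n^'n)"
  by (simp add: vec_eq_iff mat_def)

lemma mat_mult_commute: "mat c ** X = X ** (mat c :: complex^'n^'n)" for X :: "complex^'n^'n"
  by (simp add: vec_eq_iff mat_mult_component)
    (simp add: matrix_matrix_mult_def mat_def if_distrib [of "\<lambda>x. _ * x"] mult.commute cong: if_cong)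

text \<open>Defined by iterating \<open>**\<close>, since the multiplication \<open>*\<close> of
  this type is componentwise.\<close>

definition mat_power :: "complex^'n^'n \<Rightarrow> nat \<Rightarrow> complex^'n^'n"
  where "mat_power M k = (((**) M) ^^ k) (mat 1)"

lemma mat_power_0 [simp]: "mat_power M 0 = mat 1"
  by (simp add: mat_power_def)

lemma mat_power_Suc [simp]: "mat_power M (Suc k) = M ** mat_power M k"
  by (simp add: mat_power_def)

definition mat_eval :: "complex poly \<Rightarrow> complex^'n^'n \<Rightarrow> complex^'n^'n"
  where "mat_eval p M = (\<Sum>k\<le>degree p. mat (coeff p k) ** mat_power M k)"

lemma mat_eval_altdef:
  "degree p \<le> N \<Longrightarrow> mat_eval p M = (\<Sum>k\<le>N. mat (coeff p k) ** mat_power M k)"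
  unfolding mat_eval_def
  by (rule sum.mono_neutral_left) (auto simp: coeff_eq_0 not_le)

lemma mat_eval_0 [simp]: "mat_eval 0 M = 0"
  by (simp add: mat_eval_def)

lemma mat_eval_pCons: "mat_eval (pCons a p) M = mat a + M ** mat_eval p M"
proof -
  have "mat_eval (pCons a p) M
      = (\<Sum>k\<le>Suc (degree p). mat (coeff (pCons a p) k) ** mat_power M k)"
    by (rule mat_eval_altdef) (simp add: degree_pCons_le)
  also have "\<dots> = mat a + (\<Sum>k\<le>degree p. mat (coeff p k) ** (M ** mat_power M k))"
    by (subst sum.atMost_Suc_shift) simp
  also have "\<dots> = mat a + M ** mat_eval p M"
    by (simp add: mat_eval_def matrix_sum_right matrix_mul_assoc mat_mult_commute [of _ M])
  finally show ?thesis .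
qed

lemma mat_eval_add: "mat_eval (p + q) M = mat_eval p M + mat_eval q M"
proof -
  define N where "N = max (degree p) (degree q)"
  have "degree p \<le> N" "degree q \<le> N" "degree (p + q) \<le> N"
    by (simp_all add: N_def degree_add_le_max)
  then show ?thesis
    by (simp add: mat_eval_altdef [where N = N] mat_add matrix_add_left sum.distrib)
qed

lemma mat_eval_smult: "mat_eval (smult c p) M = mat c ** mat_eval p M"
  by (simp add: mat_eval_altdef [OF degree_smult_le] mat_eval_def vec_eq_iff mat_mult_component
      sum_distrib_left mult.assoc)

text \<open>Multiplicativity of evaluation for a linear factor: this turns a root \<open>x\<close>
  of a polynomial into a matrix factor \<open>M - mat x\<close>.\<close>

lemma mat_eval_mult_linear:
  "mat_eval ([:- x, 1:] * p) M = (M - mat x) ** mat_eval p M"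
  by (simp add: mat_eval_add mat_eval_smult mat_eval_pCons matrix_diff_left vec_eq_iff
      mat_mult_component flip: smult_minus_left)

lemma mat_eval_commute: "M ** mat_eval p M = mat_eval p M ** M"
  by (induction p) (simp_all add: mat_eval_pCons matrix_add_left matrix_add_ldistrib
      mat_mult_commute matrix_mul_assoc)

section \<open>Annihilating products over eigenvalues\<close>

text \<open>The matrices form a finite-dimensional space, so the powers of \<open>M\<close> are
  linearly dependent. A repeated power is treated apart, because dependence is a property of the set
  of powers and a repetition would shrink this set.\<close>

lemma mat_power_dependent:
  fixes M :: "complex^'n^'n"
  obtains q where "q \<noteq> 0" "mat_eval q M = 0"
proof (cases "inj (mat_power M)")
  case False
  then obtain i j where ij: "i \<noteq> j" "mat_power M i = mat_power M j"
    by (auto simp: inj_def)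
  define q :: "complex poly" where "q = monom 1 i - monom 1 j"
  have "coeff q i = 1" using ij by (simp add: q_def)
  then have q0: "q \<noteq> 0" by auto
  have "degree q \<le> i + j"
    unfolding q_def by (intro degree_diff_le order_trans[OF degree_monom_le]) auto
  then have "mat_eval q M = (\<Sum>k\<le>i+j. mat (coeff q k) ** mat_power M k)"
    by (rule mat_eval_altdef)
  also have "\<dots> = (\<Sum>k\<in>{i, j}. mat (coeff q k) ** mat_power M k)"
    by (rule sum.mono_neutral_right) (auto simp: q_def)
  also have "\<dots> = 0"
    using ij by (simp add: q_def vec_eq_iff mat_mult_component)
  finally show ?thesis by (rule that [OF q0])
next
  case True
  \<comment> \<open>\<open>N\<close> is the dimension over the reals, so the \<open>N + 1\<close>
    powers up to \<open>N\<close> satisfy a relation with real coefficients.\<close>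
  define N where "N = DIM(complex^'n^'n)"
  have inj: "inj_on (mat_power M) {..N}" using True by (rule inj_on_subset) simp
  have "card (mat_power M ` {..N}) = Suc N"
    by (simp add: card_image [OF inj])
  then have "dependent (mat_power M ` {..N})"
    by (intro dependent_biggerset) (simp only: N_def [symmetric] lessI)
  then obtain u v where u: "v \<in> mat_power M ` {..N}" "u v \<noteq> 0"
      "(\<Sum>w\<in>mat_power M ` {..N}. u w *\<^sub>R w) = 0"
    by (auto simp: dependent_finite)
  define c :: "nat \<Rightarrow> complex" where "c = (\<lambda>k. if k \<le> N then of_real (u (mat_power M k)) else 0)"
  define q where "q = Abs_poly c"
  have cq: "coeff q = c"
    unfolding q_def by (rule coeff_Abs_poly[of N]) (simp add: c_def)
  have q0: "q \<noteq> 0" using u by (auto simp: poly_eq_iff cq c_def)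
  have "degree q \<le> N"
    by (rule degree_le) (simp add: cq c_def)
  then have "mat_eval q M = (\<Sum>k\<le>N. mat (coeff q k) ** mat_power M k)"
    by (rule mat_eval_altdef)
  also have "\<dots> = (\<Sum>k\<le>N. u (mat_power M k) *\<^sub>R mat_power M k)"
    by (rule sum.cong) (auto simp: cq c_def vec_eq_iff mat_mult_component
        scaleR_conv_of_real [where 'a = complex])
  also have "\<dots> = 0" using u(3) by (simp add: sum.reindex[OF inj])
  finally show ?thesis by (rule that [OF q0])
qed

text \<open>A nonzero column of \<open>W\<close> would be an eigenvector of \<open>M\<close> for
  \<open>x\<close>.\<close>

lemma matrix_kernel_trivial:
  fixes M :: "complex^'n^'n" and W :: "complex^'m^'n"
  assumes "x \<notin> eigenvalues M" "(M - mat x) ** W = 0"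
  shows "W = 0"
proof -
  have "column j W = 0" for j
  proof -
    have "M ** W = mat x ** W" using assms(2) by (simp add: matrix_diff_left)
    then have "M *v column j W = x *s column j W"
      by (simp add: vec_eq_iff mat_mult_component column_def matrix_vector_mult_def)
        (simp add: matrix_matrix_mult_def)
    then show ?thesis using assms(1) by (auto simp: eigenvalues_def)
  qed
  then show ?thesis by (simp add: vec_eq_iff column_def)
qed

text \<open>Induction on the degree, splitting off one root at a time. A root that is an eigenvalue
  is kept in the list; any other root gives an injective factor, which can be cancelled.
  \<open>Z\<close> varies because a kept factor is absorbed into it.\<close>

lemma annihilating_eigenvalue_list:
  fixes M :: "complex^'n^'n" and Z :: "complex^'m^'n"
  assumes "q \<noteq> 0" "mat_eval q M ** Z = 0"
  shows "\<exists>ls. set ls \<subseteq> eigenvalues M \<and> fold (\<lambda>l X. (M - mat l) ** X) ls Z = 0"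
  using assms
proof (induction "degree q" arbitrary: q Z)
  case 0
  then obtain c where "q = [:c:]" "c \<noteq> 0" by (metis degree_eq_zeroE pCons_0_0)
  then have "Z = 0" using 0(3) by (simp add: mat_eval_pCons vec_eq_iff mat_mult_component)
  then show ?case by (intro exI[of _ "[]"]) simp
next
  case (Suc n)
  have "\<not> constant (poly q)" using Suc(2) by (simp add: constant_degree)
  then obtain x where "poly q x = 0" using fundamental_theorem_of_algebra by blast
  then obtain r where q: "q = [:- x, 1:] * r" by (auto simp: poly_eq_0_iff_dvd)
  have r: "r \<noteq> 0" "degree r = n"
    using Suc(2,3) q by (auto simp: degree_mult_eq simp del: mult_pCons_left)
  have 1: "(M - mat x) ** (mat_eval r M ** Z) = 0"
    using Suc(4) unfolding q mat_eval_mult_linear by (simp add: matrix_mul_assoc)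
  show ?case
  proof (cases "x \<in> eigenvalues M")
    case True
    \<comment> \<open>The kept factor moves to the right, where it acts on \<open>Z\<close> before
      the remaining polynomial does.\<close>
    have "(M - mat x) ** mat_eval r M = mat_eval r M ** (M - mat x)"
      by (simp add: matrix_diff_left matrix_diff_right mat_eval_commute mat_mult_commute)
    then have "mat_eval r M ** ((M - mat x) ** Z) = 0"
      using 1 by (simp add: matrix_mul_assoc)
    from Suc(1)[OF r(2)[symmetric] r(1) this] obtain ls where
      "set ls \<subseteq> eigenvalues M" "fold (\<lambda>l X. (M - mat l) ** X) ls ((M - mat x) ** Z) = 0" by blast
    then show ?thesis using True by (intro exI[of _ "x # ls"]) simp
  next
    case False
    from Suc(1)[OF r(2)[symmetric] r(1) matrix_kernel_trivial[OF this 1]] show ?thesis .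
  qed
qed

text \<open>The fold is left multiplication by a fixed matrix, so a list that annihilates
  \<open>mat 1\<close> annihilates every \<open>Z\<close>.\<close>

lemma annihilated_by_eigenvalues:
  fixes M :: "complex^'n^'n"
  obtains ls where "set ls \<subseteq> eigenvalues M"
    "\<And>Z :: complex^'m^'n. fold (\<lambda>l X. (M - mat l) ** X) ls Z = 0"
proof -
  obtain q where "q \<noteq> 0" "mat_eval q M = 0" by (rule mat_power_dependent)
  then obtain ls where ls: "set ls \<subseteq> eigenvalues M"
      "fold (\<lambda>l X. (M - mat l) ** X) ls (mat 1 :: complex^'n^'n) = 0"
    using annihilating_eigenvalue_list[of q M "mat 1"] by auto
  have "fold (\<lambda>l X. (M - mat l) ** X) ls (X ** Z) = fold (\<lambda>l X. (M - mat l) ** X) ls X ** Z"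
    for X :: "complex^'n^'n" and Z :: "complex^'m^'n"
    by (induction ls arbitrary: X) (simp_all add: matrix_mul_assoc)
  from this[of "mat 1"] ls show ?thesis by (intro that[of ls]) simp_all
qed

text \<open>On an eigenvector for \<open>k\<close> the annihilating product acts as the scalar
  product of all \<open>k - l\<close>. This scalar must vanish, so \<open>k\<close> occurs in the
  list. Finiteness makes the \<open>Max\<close> in \<open>spectral_abscissa\<close> an upper
  bound.\<close>

lemma finite_eigenvalues:
  fixes M :: "complex^'n^'n"
  shows "finite (eigenvalues M)"
proof -
  obtain ls where "set ls \<subseteq> eigenvalues M"
    and ls: "\<And>Z :: complex^'n^'n. fold (\<lambda>l X. (M - mat l) ** X) ls Z = 0"
    using annihilated_by_eigenvalues [of M] by blast
  have "k \<in> set ls" if "k \<in> eigenvalues M" for k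
  proof -
    from that obtain v where v: "v \<noteq> 0" "M *v v = k *s v" by (auto simp: eigenvalues_def)
    have eq: "(M - mat l) *v (c *s v) = ((k - l) * c) *s v" for l c
    proof -
      have "mat l *v x = l *s x" for x :: "complex^'n"
        by (simp add: vec_eq_iff matrix_vector_mult_def mat_def if_distrib [of "\<lambda>x. x * _"]
            cong: if_cong)
      then have "(M - mat l) *v (c *s v) = c *s (M *v v) - l *s (c *s v)"
        by (simp add: matrix_vector_mult_diff_rdistrib vector_scalar_commute)
      then show ?thesis by (simp add: v vec_eq_iff algebra_simps)
    qed
    have "fold (\<lambda>l X. (M - mat l) ** X) ls' Z *v v = ((\<Prod>l\<leftarrow>ls'. k - l) * c) *s v"
      if "Z *v v = c *s v" for ls' c and Z :: "complex^'n^'n"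
      using that
    proof (induction ls' arbitrary: Z c)
      case (Cons l ls')
      have "((M - mat l) ** Z) *v v = ((k - l) * c) *s v"
        using Cons(2) by (simp add: eq flip: matrix_vector_mul_assoc)
      from Cons(1)[OF this] show ?case by (simp add: mult_ac)
    qed simp
    from this[of "mat 1" 1 ls] have "(\<Prod>l\<leftarrow>ls. k - l) *s v = 0" by (simp add: ls)
    then have "(\<Prod>l\<leftarrow>ls. k - l) = 0" using v by simp
    then show ?thesis by (auto simp: prod_list_zero_iff)
  qed
  then show ?thesis by (meson finite_set finite_subset subsetI)
qed

section \<open>Exponential growth bounds for linear differential equations\<close>

lemma norm_vec_le_sum: "norm x \<le> (\<Sum>i\<in>UNIV. norm (x $ i))"
  unfolding norm_vec_def by (rule L2_set_le_sum) simp

text \<open>With the integrating factor, \<open>h\<close> has a derivative of norm at most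
  \<open>K * exp (c * t)\<close>, where \<open>c = b - Re l\<close>. Comparison with the primitive
  \<open>K / c * exp (c * t)\<close> bounds \<open>h\<close>, and multiplying back gives the rate
  \<open>b\<close>. Strictness of \<open>Re l < b\<close> makes \<open>c\<close> positive; for
  \<open>c = 0\<close> the comparison would produce a factor \<open>t\<close>.\<close>

lemma scalar_linear_ode_bound:
  fixes u w :: "real \<Rightarrow> complex"
  assumes u: "\<And>t. t \<ge> 0 \<Longrightarrow> (u has_vector_derivative l * u t + w t) (at t within {0..})"
    and w: "\<And>t. t \<ge> 0 \<Longrightarrow> norm (w t) \<le> K * exp (b * t)"
    and l: "Re l < b"
  obtains K' where "\<And>t. t \<ge> 0 \<Longrightarrow> norm (u t) \<le> K' * exp (b * t)"
proof -
  define c where "c = b - Re l"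
  have c: "c > 0" using l by (simp add: c_def)
  have K: "K \<ge> 0" using order_trans [OF norm_ge_zero w [of 0]] by simp
  define h where "h = (\<lambda>t. exp (- (t *\<^sub>R l)) * u t)"
  have hd: "(h has_vector_derivative exp (- (t *\<^sub>R l)) * w t) (at t within {0..})" if "t \<ge> 0" for t
    unfolding h_def
    using has_vector_derivative_mult [OF exp_scaleR_has_vector_derivative_right [of "- l"] u [OF that]]
    by (simp add: algebra_simps)
  have hb: "norm (h t) \<le> norm (h 0) + K / c * exp (c * t)" if t: "t \<ge> 0" for t
  proof (cases "t = 0")
    case True
    then show ?thesis using K c by simp
  next
    case False
    then have t: "0 < t" using t by simp
    have "norm (h t - h 0) \<le> K / c * exp (c * t) - K / c * exp (c * 0)"
    proof (rule differentiable_bound_general[OF t])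
      show "continuous_on {0..t} h"
        using continuous_on_vector_derivative [of "{0..}", OF hd]
        by (rule continuous_on_subset) auto
      show "continuous_on {0..t} (\<lambda>s. K / c * exp (c * s))" by (intro continuous_intros)
      fix s assume s: "0 < s" "s < t"
      then have "at s within {0..} = at s"
        by (intro at_within_interior) simp
      then show "(h has_vector_derivative exp (- (s *\<^sub>R l)) * w s) (at s)"
        using hd[of s] s by simp
      show "((\<lambda>s. K / c * exp (c * s)) has_vector_derivative K * exp (c * s)) (at s)"
        using c by (auto intro!: derivative_eq_intros simp flip: has_real_derivative_iff_has_vector_derivative)
      show "norm (exp (- (s *\<^sub>R l)) * w s) \<le> K * exp (c * s)"
      proof -
        have "norm (exp (- (s *\<^sub>R l)) * w s) = exp (- (s * Re l)) * norm (w s)"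
          by (simp add: norm_mult)
        also have "\<dots> \<le> exp (- (s * Re l)) * (K * exp (b * s))"
          using w[of s] s by (intro mult_left_mono) auto
        also have "\<dots> = K * exp (c * s)"
          by (simp add: c_def algebra_simps flip: exp_add)
        finally show ?thesis .
      qed
    qed
    moreover have "norm (h t) \<le> norm (h 0) + norm (h t - h 0)"
      by (rule norm_triangle_sub)
    moreover have "0 \<le> K / c" using K c by simp
    ultimately show ?thesis by simp
  qed
  show ?thesis
  proof (rule that[of "norm (h 0) + K / c"])
    fix t :: real assume t: "t \<ge> 0"
    have "u t = exp (t *\<^sub>R l) * h t"
      by (simp add: h_def exp_minus)
    then have "norm (u t) = exp (t * Re l) * norm (h t)"
      by (simp add: norm_mult)
    also have "\<dots> \<le> exp (t * Re l) * (norm (h 0) + K / c * exp (c * t))"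
      using hb[OF t] by simp
    also have "\<dots> \<le> exp (t * Re l) * (norm (h 0) * exp (c * t) + K / c * exp (c * t))"
      using mult_left_mono [of 1 "exp (c * t)" "norm (h 0)"] c t by simp
    also have "\<dots> = (norm (h 0) + K / c) * exp (b * t)"
      by (simp add: c_def algebra_simps flip: exp_add)
    finally show "norm (u t) \<le> (norm (h 0) + K / c) * exp (b * t)" .
  qed
qed

text \<open>Peel off the first factor: \<open>W = (M - mat l) ** Y\<close> solves the same equation,
  since the factor commutes with \<open>M\<close>, and is annihilated by the rest of the list. Since
  \<open>M ** Y\<close> equals \<open>mat l ** Y + W\<close>, each entry of \<open>Y\<close> solves
  a scalar equation whose inhomogeneity is bounded by induction.\<close>

lemma matrix_ode_bound_component:
  fixes M :: "complex^'n^'n" and Y :: "real \<Rightarrow> complex^'m^'n"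
  assumes "\<And>t. t \<ge> 0 \<Longrightarrow> (Y has_vector_derivative M ** Y t) (at t within {0..})"
    and "\<And>t. t \<ge> 0 \<Longrightarrow> fold (\<lambda>l X. (M - mat l) ** X) ls (Y t) = 0"
    and "\<forall>l\<in>set ls. Re l < b"
  shows "\<exists>K. \<forall>t\<ge>0. norm (Y t $ i $ j) \<le> K * exp (b * t)"
  using assms
proof (induction ls arbitrary: Y)
  case Nil
  then show ?case by (intro exI[of _ 0]) simp
next
  case (Cons l ls)
  have lin: "bounded_linear (\<lambda>X :: complex^'m^'n. A ** X)" for A :: "complex^'n^'n"
    by (intro linear_conv_bounded_linear[THEN iffD1] linearI)
      (simp_all add: matrix_add_ldistrib matrix_scaleR_right)
  define W where "W t = (M - mat l) ** Y t" for t
  have "(W has_vector_derivative (M - mat l) ** (M ** Y t)) (at t within {0..})" if "t \<ge> 0" for t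
    unfolding W_def by (rule bounded_linear.has_vector_derivative[OF lin Cons(2)[OF that]])
  moreover have "(M - mat l) ** (M ** X) = M ** ((M - mat l) ** X)" for X :: "complex^'m^'n"
    by (simp add: matrix_mul_assoc matrix_diff_left matrix_diff_right mat_mult_commute)
  ultimately have "(W has_vector_derivative M ** W t) (at t within {0..})" if "t \<ge> 0" for t
    using that by (simp add: W_def)
  moreover have "fold (\<lambda>l X. (M - mat l) ** X) ls (W t) = 0" if "t \<ge> 0" for t
    using Cons(3) [OF that] by (simp add: W_def)
  ultimately obtain K where K: "\<And>t. t \<ge> 0 \<Longrightarrow> norm (W t $ i $ j) \<le> K * exp (b * t)"
    using Cons(1) [of W] Cons(4) by auto
  have "((\<lambda>t. Y t $ i $ j) has_vector_derivative l * Y t $ i $ j + W t $ i $ j) (at t within {0..})"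
    if "t \<ge> 0" for t
  proof -
    have "bounded_linear (\<lambda>X :: complex^'m^'n. X $ i $ j)"
      by (intro bounded_linear_compose[OF bounded_linear_vec_nth bounded_linear_vec_nth])
    from bounded_linear.has_vector_derivative[OF this Cons(2)[OF that]]
    show ?thesis by (simp add: W_def matrix_diff_left mat_mult_component)
  qed
  from scalar_linear_ode_bound[OF this K] Cons(4) obtain K' where
    "\<And>t. t \<ge> 0 \<Longrightarrow> norm (Y t $ i $ j) \<le> K' * exp (b * t)" by auto
  then show ?case by blast
qed

lemma matrix_ode_bound:
  fixes M :: "complex^'n^'n" and Y :: "real \<Rightarrow> complex^'m^'n"
  assumes "\<And>t. t \<ge> 0 \<Longrightarrow> (Y has_vector_derivative M ** Y t) (at t within {0..})"
    and "\<And>l. l \<in> eigenvalues M \<Longrightarrow> Re l < b"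
  obtains K where "\<And>t. t \<ge> 0 \<Longrightarrow> norm (Y t) \<le> K * exp (b * t)"
proof -
  obtain ls where ls: "set ls \<subseteq> eigenvalues M"
      "\<And>Z :: complex^'m^'n. fold (\<lambda>l X. (M - mat l) ** X) ls Z = 0"
    using annihilated_by_eigenvalues [of M] by blast
  have "\<exists>K. \<forall>t\<ge>0. norm (Y t $ i $ j) \<le> K * exp (b * t)" for i j
    by (rule matrix_ode_bound_component [of Y M ls]) (use assms ls in auto)
  then obtain K where K: "\<And>i j t. t \<ge> 0 \<Longrightarrow> norm (Y t $ i $ j) \<le> K i j * exp (b * t)"
    by metis
  have "norm (Y t) \<le> (\<Sum>i\<in>UNIV. \<Sum>j\<in>UNIV. K i j) * exp (b * t)" if "t \<ge> 0" for t
  proof -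
    have "norm (Y t) \<le> (\<Sum>i\<in>UNIV. norm (Y t $ i))" by (rule norm_vec_le_sum)
    also have "\<dots> \<le> (\<Sum>i\<in>UNIV. \<Sum>j\<in>UNIV. norm (Y t $ i $ j))"
      by (intro sum_mono norm_vec_le_sum)
    also have "\<dots> \<le> (\<Sum>i\<in>UNIV. \<Sum>j\<in>UNIV. K i j * exp (b * t))"
      by (intro sum_mono K that)
    finally show ?thesis by (simp add: sum_distrib_right)
  qed
  then show ?thesis by (rule that)
qed

section \<open>Bimatrix algebra and the bimatrix exponential\<close>

lemmas bi_mult_add_left = bounded_bilinear.add_left [OF bounded_bilinear_bi_mult]
  and bi_mult_add_right = bounded_bilinear.add_right [OF bounded_bilinear_bi_mult]
  and bi_mult_scaleR_left = bounded_bilinear.scaleR_left [OF bounded_bilinear_bi_mult]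
  and bi_mult_scaleR_right = bounded_bilinear.scaleR_right [OF bounded_bilinear_bi_mult]
  and bi_mult_zero_left = bounded_bilinear.zero_left [OF bounded_bilinear_bi_mult]
  and bi_mult_zero_right = bounded_bilinear.zero_right [OF bounded_bilinear_bi_mult]

text \<open>The two left blocks of the lifting recover the pair. Identities between bimatrices can
  thus be checked on complex matrices.\<close>

lemma lifting_inject: "lifting A = lifting B \<longleftrightarrow> A = B"
proof
  assume eq: "lifting A = lifting B"
  have "lifting A $ Inl i $ Inl j = lifting B $ Inl i $ Inl j"
    "lifting A $ Inr i $ Inl j = lifting B $ Inr i $ Inl j" for i j
    by (simp_all only: eq)
  then show "A = B" by (cases A; cases B) (simp add: vec_eq_iff)
qed simp

lemma bi_mult_assoc: "A **\<^sub>b B **\<^sub>b C = A **\<^sub>b (B **\<^sub>b C)"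
  by (simp add: lifting_mult matrix_mul_assoc flip: lifting_inject)

lemma bi_mult_id_left [simp]: "bi_id **\<^sub>b A = A"
  by (simp add: lifting_mult lifting_id flip: lifting_inject)

lemma bi_mult_id_right [simp]: "A **\<^sub>b bi_id = A"
  by (simp add: lifting_mult lifting_id flip: lifting_inject)

lemma linear_lifting: "linear lifting"
  by (rule linearI) (auto simp: vec_eq_iff split: sum.split)

lemma bounded_linear_lifting: "bounded_linear lifting"
  using linear_lifting by (simp add: linear_conv_bounded_linear)

lemma linear_bi_herm: "linear bi_herm"
  by (rule linearI) (auto simp: vec_eq_iff herm_mat_def transpose_def)

lemma bounded_linear_bi_herm: "bounded_linear bi_herm"
  using linear_bi_herm by (simp add: linear_conv_bounded_linear)

lemma bi_herm_mult: "bi_herm (A **\<^sub>b B) = bi_herm B **\<^sub>b bi_herm A"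
  by (simp add: lifting_mult lifting_herm herm_mat_def cnj_mat_mult matrix_transpose_mul
      flip: lifting_inject)

lemma bi_herm_id: "bi_herm bi_id = bi_id"
  by (simp add: bi_id_def herm_mat_def vec_eq_iff transpose_def mat_def)

lemma bi_power_commute: "A **\<^sub>b bi_power A k = bi_power A k **\<^sub>b A"
  by (induction k) (simp_all flip: bi_mult_assoc)

lemma bi_power_scaleR: "bi_power (t *\<^sub>R A) k = t ^ k *\<^sub>R bi_power A k"
  by (induction k) (simp_all add: bi_mult_scaleR_left bi_mult_scaleR_right)

text \<open>The adjoint reverses products, which does no harm to powers of a single
  bimatrix.\<close>

lemma bi_power_herm: "bi_power (bi_herm A) k = bi_herm (bi_power A k)"
  by (induction k) (simp_all add: bi_herm_id bi_power_commute bi_herm_mult)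

lemma bi_exp_herm: "bi_exp (bi_herm A) = bi_herm (bi_exp A)"
  unfolding bi_exp_def bounded_linear.suminf [OF bounded_linear_bi_herm summable_bi_exp]
  by (simp add: bi_power_herm linear_scale [OF linear_bi_herm])

lemma bi_exp_0: "bi_exp 0 = bi_id"
proof -
  have "bi_power 0 k = 0" if "k \<noteq> 0" for k
    using that by (cases k) (simp_all add: bi_mult_zero_left)
  then show ?thesis
    unfolding bi_exp_def by (subst suminf_finite [of "{0}"]) simp_all
qed

lemma bi_exp_commute: "A **\<^sub>b bi_exp (t *\<^sub>R A) = bi_exp (t *\<^sub>R A) **\<^sub>b A"
  unfolding bi_exp_def
    bounded_linear.suminf [OF bounded_bilinear.bounded_linear_right [OF bounded_bilinear_bi_mult] summable_bi_exp]
    bounded_linear.suminf [OF bounded_bilinear.bounded_linear_left [OF bounded_bilinear_bi_mult] summable_bi_exp]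
  by (simp add: bi_power_scaleR bi_mult_scaleR_left bi_mult_scaleR_right bi_power_commute)

text \<open>The inner product with a fixed \<open>b\<close> turns the exponential into a real power
  series in \<open>t\<close> that converges everywhere and is differentiated term by term.
  Derivatives are then reassembled from components.\<close>

lemma bi_exp_has_vector_derivative:
  "((\<lambda>t. bi_exp (t *\<^sub>R A)) has_vector_derivative A **\<^sub>b bi_exp (t *\<^sub>R A)) (at t within S)"
proof -
  have "((\<lambda>t. bi_exp (t *\<^sub>R A) \<bullet> b) has_real_derivative (A **\<^sub>b bi_exp (t *\<^sub>R A)) \<bullet> b) (at t)" for b
  proof -
    define c where "c k = (bi_power A k \<bullet> b) / fact k" for k
    have bl: "bounded_linear (\<lambda>X. X \<bullet> b)" by (rule bounded_linear_inner_left)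
    have trm: "(bi_power (s *\<^sub>R A) k /\<^sub>R fact k) \<bullet> b = c k * s ^ k" for s k
      by (simp add: c_def bi_power_scaleR divide_inverse mult_ac)
    have sm: "summable (\<lambda>k. c k * s ^ k)" for s
      using bounded_linear.summable [OF bl summable_bi_exp [of "s *\<^sub>R A"]] by (simp only: trm)
    have e: "bi_exp (s *\<^sub>R A) \<bullet> b = (\<Sum>k. c k * s ^ k)" for s
      unfolding bi_exp_def bounded_linear.suminf [OF bl summable_bi_exp] by (simp only: trm)
    have bl': "bounded_linear (\<lambda>X. (A **\<^sub>b X) \<bullet> b)"
      by (rule bounded_linear_compose [OF bl bounded_bilinear.bounded_linear_right [OF bounded_bilinear_bi_mult]])
    \<comment> \<open>\<open>diffs\<close> shifts the index: the factor \<open>k + 1\<close> cancels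
      against the factorial of \<open>k + 1\<close>, and the additional power of \<open>A\<close> is
      the one on the left-hand side.\<close>
    have "(A **\<^sub>b bi_exp (t *\<^sub>R A)) \<bullet> b = (\<Sum>k. diffs c k * t ^ k)"
      unfolding bi_exp_def bounded_linear.suminf [OF bl' summable_bi_exp]
      by (rule suminf_cong)
        (simp add: diffs_def c_def bi_power_scaleR bi_mult_scaleR_right divide_simps)
    then show ?thesis
      unfolding e using termdiffs_strong_converges_everywhere [OF sm, of t] by simp
  qed
  then have "((\<lambda>t. bi_exp (t *\<^sub>R A) \<bullet> b) has_vector_derivative (A **\<^sub>b bi_exp (t *\<^sub>R A)) \<bullet> b)
      (at t within S)" for b
    by (metis has_real_derivative_iff_has_vector_derivative has_vector_derivative_at_within)
  then show ?thesis
    unfolding has_vector_derivative_def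
    by (subst has_derivative_componentwise_within) simp
qed

text \<open>Product rule. Since \<open>A\<close> and \<open>F\<close> commute with their own
  exponentials, the derivative is again such a sandwich, with
  \<open>A **\<^sub>b X + X **\<^sub>b F\<close> in place of \<open>X\<close>.\<close>

lemma bi_exp_sandwich_has_vector_derivative:
  fixes A F X
  defines "f \<equiv> \<lambda>t. bi_exp (t *\<^sub>R A) **\<^sub>b X **\<^sub>b bi_exp (t *\<^sub>R F)"
  shows "(f has_vector_derivative A **\<^sub>b f t + f t **\<^sub>b F) (at t within S)"
    and "A **\<^sub>b f t + f t **\<^sub>b F = bi_exp (t *\<^sub>R A) **\<^sub>b (A **\<^sub>b X + X **\<^sub>b F) **\<^sub>b bi_exp (t *\<^sub>R F)"
proof -
  note bb = bounded_bilinear.has_vector_derivative [OF bounded_bilinear_bi_mult]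
  have left: "((\<lambda>t. bi_exp (t *\<^sub>R A) **\<^sub>b X) has_vector_derivative A **\<^sub>b bi_exp (t *\<^sub>R A) **\<^sub>b X) (at t within S)"
    by (rule bounded_linear.has_vector_derivative
        [OF bounded_bilinear.bounded_linear_left [OF bounded_bilinear_bi_mult] bi_exp_has_vector_derivative])
  show "(f has_vector_derivative A **\<^sub>b f t + f t **\<^sub>b F) (at t within S)"
    using bb [OF left bi_exp_has_vector_derivative [of F]] unfolding f_def
    by (simp add: bi_mult_assoc bi_exp_commute [of F] add.commute)
  show "A **\<^sub>b f t + f t **\<^sub>b F = bi_exp (t *\<^sub>R A) **\<^sub>b (A **\<^sub>b X + X **\<^sub>b F) **\<^sub>b bi_exp (t *\<^sub>R F)"
    unfolding f_def
    by (simp add: bi_mult_add_left bi_mult_add_right bi_mult_assoc flip: bi_exp_commute [of F])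
      (simp add: bi_exp_commute flip: bi_mult_assoc)
qed

text \<open>The lifted exponential solves the matrix equation for \<open>lifting A\<close>. The
  bound passes back because an injective linear map in finite dimension is bounded below.\<close>

lemma bi_exp_bound:
  fixes A :: "('n::finite, 'n) bimatrix"
  assumes "\<And>l. l \<in> eigenvalues (lifting A) \<Longrightarrow> Re l < b"
  obtains K where "\<And>t. t \<ge> 0 \<Longrightarrow> norm (bi_exp (t *\<^sub>R A)) \<le> K * exp (b * t)"
proof -
  have "((\<lambda>t. lifting (bi_exp (t *\<^sub>R A))) has_vector_derivative lifting A ** lifting (bi_exp (t *\<^sub>R A)))
      (at t within {0..})" for t
    using bounded_linear.has_vector_derivative [OF bounded_linear_lifting bi_exp_has_vector_derivative]
    by (simp add: lifting_mult)
  from matrix_ode_bound [OF this assms] obtain K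
    where K: "\<And>t. t \<ge> 0 \<Longrightarrow> norm (lifting (bi_exp (t *\<^sub>R A))) \<le> K * exp (b * t)" by blast
  have "inj (lifting :: ('n, 'n) bimatrix \<Rightarrow> _)" by (simp add: inj_def lifting_inject)
  then obtain B where B: "B > 0" "\<And>X :: ('n, 'n) bimatrix. B * norm X \<le> norm (lifting X)"
    using linear_inj_bounded_below_pos [OF linear_lifting] by metis
  have "norm (bi_exp (t *\<^sub>R A)) \<le> (K / B) * exp (b * t)" if "t \<ge> 0" for t
    using B(2) [of "bi_exp (t *\<^sub>R A)"] K [OF that] B(1) by (simp add: field_simps)
  then show ?thesis by (rule that)
qed

section \<open>Improper integrals and the Sylvester equation\<close>

text \<open>The fundamental theorem of calculus on bounded intervals, followed by dominated
  convergence.\<close>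

lemma has_integral_derivative_exp_decay:
  fixes f f' :: "real \<Rightarrow> 'a::euclidean_space"
  assumes deriv: "\<And>t. t \<ge> 0 \<Longrightarrow> (f has_vector_derivative f' t) (at t within {0..})"
    and int: "f' integrable_on {0..}"
    and c: "c > 0" and bound: "\<And>t. t \<ge> 0 \<Longrightarrow> norm (f' t) \<le> J * exp (- c * t)"
    and lim: "(f \<longlongrightarrow> 0) at_top"
  shows "(f' has_integral - f 0) {0..}"
proof -
  \<comment> \<open>Truncation at natural numbers gives the sequence that dominated convergence
    requires.\<close>
  define g where "g n t = (if t \<in> {0..real n} then f' t else 0)" for n t
  have ftc: "(f' has_integral f n - f 0) {0..real n}" for n
    using fundamental_theorem_of_calculus [of 0 "real n" f f'] deriv
    by (force intro: has_vector_derivative_within_subset)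
  have g: "(g n has_integral f n - f 0) {0..}" for n
    using ftc [of n] has_integral_restrict [of "{0..real n}" "{0..}" f' "f n - f 0"]
    unfolding g_def by (simp add: Ball_def)
  have "(\<lambda>n. integral {0..} (g n)) \<longlonglongrightarrow> integral {0..} f'"
  proof (rule dominated_convergence)
    show "(\<lambda>t. J * exp (- c * t)) integrable_on {0..}"
      using integrable_on_cmult_left [OF integrable_on_exp_minus_to_infinity [OF c], of J] by simp
    show "g n integrable_on {0..}" for n
      using g by blast
    show "norm (g n t) \<le> J * exp (- c * t)" if "t \<in> {0..}" for n t
      using bound [of t] that order_trans [OF norm_ge_zero bound [of t]] by (simp add: g_def)
    show "(\<lambda>n. g n t) \<longlonglongrightarrow> f' t" if "t \<in> {0..}" for t
    proof (rule tendsto_eventually)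
      have "\<forall>\<^sub>F n in sequentially. t \<le> real n"
        using filterlim_real_sequentially by (simp add: filterlim_at_top)
      then show "\<forall>\<^sub>F n in sequentially. g n t = f' t"
        by eventually_elim (use that in \<open>simp add: g_def\<close>)
    qed
  qed
  moreover have "(\<lambda>n. integral {0..} (g n)) \<longlonglongrightarrow> 0 - f 0"
    unfolding integral_unique [OF g]
    by (intro tendsto_diff tendsto_const filterlim_compose [OF lim filterlim_real_sequentially])
  ultimately have "integral {0..} f' = - f 0"
    using LIMSEQ_unique by fastforce
  with int show ?thesis
    by (simp add: has_integral_integrable_integral)
qed

text \<open>Growth rates are assumed instead of spectra, so that the Lyapunov equation is covered
  too. Let \<open>S X t\<close> be the sandwich around \<open>X\<close> and \<open>D\<close> the
  operator of the equation; then \<open>D\<close> commutes with \<open>S\<close> and the derivative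
  of \<open>S X\<close> is \<open>S (D X)\<close>.\<close>

lemma sylvester_solution:
  fixes A :: "('n::finite, 'n) bimatrix" and F :: "('p::finite, 'p) bimatrix"
    and C :: "('p, 'n) bimatrix"
  assumes A: "\<And>t. t \<ge> 0 \<Longrightarrow> norm (bi_exp (t *\<^sub>R A)) \<le> K * exp (a * t)"
    and F: "\<And>t. t \<ge> 0 \<Longrightarrow> norm (bi_exp (t *\<^sub>R F)) \<le> L * exp (b * t)"
    and ab: "a + b < 0"
  defines "f \<equiv> \<lambda>t. bi_exp (t *\<^sub>R A) **\<^sub>b C **\<^sub>b bi_exp (t *\<^sub>R F)"
  shows "f integrable_on {0..}"
    and "\<exists>!X. A **\<^sub>b X + X **\<^sub>b F = - C"
    and "A **\<^sub>b integral {0..} f + integral {0..} f **\<^sub>b F = - C"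
proof -
  define c where "c = - (a + b)"
  have c: "c > 0" using ab by (simp add: c_def)
  define S where "S X t = bi_exp (t *\<^sub>R A) **\<^sub>b X **\<^sub>b bi_exp (t *\<^sub>R F)"
    for X :: "('p, 'n) bimatrix" and t :: real
  define D where "D X = A **\<^sub>b X + X **\<^sub>b F" for X :: "('p, 'n) bimatrix"
  have S0: "S X 0 = X" for X
    by (simp add: S_def bi_exp_0)
  have deriv: "(S X has_vector_derivative S (D X) t) (at t within T)" for X t T
    using bi_exp_sandwich_has_vector_derivative [where A = A and F = F] by (simp add: S_def [abs_def] D_def)
  have DS: "D (S X t) = S (D X) t" for X t
    using bi_exp_sandwich_has_vector_derivative(2) [where A = A and F = F] by (simp add: S_def D_def)
  have "\<exists>J. \<forall>t\<ge>0. norm (S X t) \<le> J * exp (- c * t)" for X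
  proof -
    \<comment> \<open>The product is bounded once for each of the two combinations of dimensions,
      hence two constants.\<close>
    obtain K1 where K1: "K1 > 0"
        "\<And>U V. norm (U **\<^sub>b V :: ('p, 'n) bimatrix) \<le> norm (U :: ('n, 'n) bimatrix) * norm V * K1"
      using bounded_bilinear.pos_bounded [OF bounded_bilinear_bi_mult] by blast
    obtain K2 where K2: "K2 > 0"
        "\<And>U V. norm (U **\<^sub>b V :: ('p, 'n) bimatrix) \<le> norm U * norm (V :: ('p, 'p) bimatrix) * K2"
      using bounded_bilinear.pos_bounded [OF bounded_bilinear_bi_mult] by blast
    have "norm (S X t) \<le> (K * norm X * K1 * L * K2) * exp (- c * t)" if t: "t \<ge> 0" for t
    proof -
      have "norm (S X t) \<le> norm (bi_exp (t *\<^sub>R A) **\<^sub>b X) * norm (bi_exp (t *\<^sub>R F)) * K2"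
        unfolding S_def by (rule K2)
      also have "\<dots> \<le> ((K * exp (a * t)) * norm X * K1) * (L * exp (b * t)) * K2"
      proof (intro mult_right_mono mult_mono F t norm_ge_zero order_trans [OF K1(2)] A)
        show "0 \<le> K * exp (a * t) * norm X * K1"
          using K1(1) order_trans [OF norm_ge_zero A [OF t]] by simp
      qed (use K1 K2 in simp_all)
      also have "\<dots> = (K * norm X * K1 * L * K2) * exp (- c * t)"
        by (simp add: c_def algebra_simps flip: exp_add)
      finally show ?thesis .
    qed
    then show ?thesis by blast
  qed
  then obtain J where J: "\<And>X t. t \<ge> 0 \<Longrightarrow> norm (S X t) \<le> J X * exp (- c * t)"
    by metis
  have lim: "(S X \<longlongrightarrow> 0) at_top" for X
  proof (rule Lim_null_comparison)
    show "\<forall>\<^sub>F t in at_top. norm (S X t) \<le> J X * exp (- c * t)"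
      using eventually_ge_at_top [of 0] by eventually_elim (rule J)
    have "filterlim (\<lambda>t. c * t) at_top at_top"
      using c by (intro filterlim_tendsto_pos_mult_at_top [OF tendsto_const _ filterlim_ident])
    then have "((\<lambda>t. exp (- (c * t))) \<longlongrightarrow> 0) at_top"
      by (intro filterlim_compose [OF exp_at_bot] filterlim_uminus_at_top [THEN iffD1])
    then show "((\<lambda>t. J X * exp (- c * t)) \<longlongrightarrow> 0) at_top"
      using tendsto_mult_right_zero by simp
  qed
  have int: "S X integrable_on {0..}" for X
  proof (rule measurable_bounded_by_integrable_imp_integrable)
    show "S X \<in> borel_measurable (lebesgue_on {0..})"
      using continuous_on_vector_derivative [of "{0..}", OF deriv]
      by (rule continuous_imp_measurable_on_sets_lebesgue) simp
    show "(\<lambda>t. J X * exp (- c * t)) integrable_on {0..}"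
      using integrable_on_cmult_left [OF integrable_on_exp_minus_to_infinity [OF c], of "J X"] by simp
  qed (use J in auto)
  have fS: "f = S C" by (simp add: f_def S_def fun_eq_iff)
  show "f integrable_on {0..}" unfolding fS by (rule int)
  have D: "bounded_linear D"
    unfolding D_def
    by (intro bounded_linear_add bounded_bilinear.bounded_linear_left
        bounded_bilinear.bounded_linear_right bounded_bilinear_bi_mult)
  \<comment> \<open>The integral of \<open>S (D C)\<close> is computed twice: as that of a
    derivative it is \<open>- C\<close>, and pulling \<open>D\<close> out of it yields
    \<open>D\<close> of the integral of \<open>f\<close>.\<close>
  have "(S (D C) has_integral - S C 0) {0..}"
    by (rule has_integral_derivative_exp_decay [OF deriv int c J lim])
  moreover have "(S (D C) has_integral D (integral {0..} f)) {0..}"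
    using has_integral_linear [OF integrable_integral [OF int] D, of C]
    by (simp add: o_def DS fS)
  ultimately have DI: "D (integral {0..} f) = - C"
    using has_integral_unique S0 by metis
  then show "A **\<^sub>b integral {0..} f + integral {0..} f **\<^sub>b F = - C"
    by (simp add: D_def)
  have "X = Y" if "D X = - C" "D Y = - C" for X Y
  proof -
    \<comment> \<open>The sandwich around \<open>X - Y\<close> then has derivative zero, so it stays
      at its initial value \<open>X - Y\<close>; but it also tends to zero.\<close>
    have "D (X - Y) = 0" using that by (simp add: linear_diff [OF bounded_linear.linear [OF D]])
    moreover have "S 0 = (\<lambda>t. 0)"
      by (simp add: S_def fun_eq_iff bi_mult_zero_left bi_mult_zero_right)
    ultimately have "(S (X - Y) has_vector_derivative 0) (at t within UNIV)" for t
      using deriv [of "X - Y"] by simp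
    then obtain Z where "\<And>t. S (X - Y) t = Z"
      using has_vector_derivative_zero_constant [OF convex_UNIV] by (metis UNIV_I)
    then have const: "S (X - Y) = (\<lambda>t. X - Y)"
      using S0 [of "X - Y"] by (simp add: fun_eq_iff)
    then have "X - Y = 0"
      using lim [of "X - Y"] by (simp add: tendsto_const_iff)
    then show ?thesis by simp
  qed
  with DI show "\<exists>!X. A **\<^sub>b X + X **\<^sub>b F = - C"
    unfolding D_def by blast
qed

section \<open>Asymptotic stability and the spectrum of the lifting\<close>

text \<open>An eigenvector with \<open>Re l \<ge> 0\<close> yields a family of trajectories.
  Attractivity sends all of them to zero, which forces both halves of the eigenvector to
  vanish.\<close>

lemma eigenvalues_asymptotically_stable:
  fixes A :: "('n::finite, 'n) bimatrix" and B :: "('m::finite, 'n) bimatrix"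
  assumes stable: "asymptotically_stable A B" and l: "l \<in> eigenvalues (lifting A)"
  shows "Re l < 0"
proof (rule ccontr)
  assume "\<not> Re l < 0"
  then have re: "Re l \<ge> 0" by simp
  obtain A1 A2 where A: "A = (A1, A2)" by (cases A)
  from l obtain w where w: "w \<noteq> 0" "lifting A *v w = l *s w" by (auto simp: eigenvalues_def)
  define a b where "a = (\<chi> i. w $ Inl i)" and "b = (\<chi> i. cnj (w $ Inr i))"
  have "(lifting A *v w) $ Inl i = l * w $ Inl i" "(lifting A *v w) $ Inr i = l * w $ Inr i" for i
    by (simp_all add: w(2))
  then have ab: "A1 *v a + cnj_mat A2 *v cnj_vec b = l *s a"
    and "A2 *v a + cnj_mat A1 *v cnj_vec b = l *s cnj_vec b"
    by (simp_all add: A matrix_vector_mult_def sum_UNIV_Plus vec_eq_iff a_def b_def cnj_vec_def)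
  \<comment> \<open>Conjugating the lower block equation exchanges \<open>a\<close> with
    \<open>b\<close> and \<open>l\<close> with \<open>cnj l\<close>.\<close>
  from arg_cong [OF this(2), of cnj_vec]
  have ba: "A1 *v b + cnj_mat A2 *v cnj_vec a = cnj l *s b"
    by (simp add: cnj_vec_add cnj_vec_mult cnj_vec_cnj_vec cnj_mat_cnj_mat add.commute)
      (simp add: cnj_vec_def vec_eq_iff)
  \<comment> \<open>The eigenvector \<open>(a, b\<^sup>#)\<close> for \<open>l\<close> has the mirror image \<open>(b, a\<^sup>#)\<close> for the conjugate of \<open>l\<close>;
    only sums of the two solutions have the form \<open>(x, x\<^sup>#)\<close>, and \<open>c = 1, \<i>\<close> recover them separately.\<close>
  define x where "x c t = (c * exp (t *\<^sub>R l)) *s a + (cnj c * exp (t *\<^sub>R cnj l)) *s b" for c t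
  have traj: "is_trajectory A B (\<lambda>_. 0) (x c)" for c
    unfolding is_trajectory_def
  proof (intro allI impI)
    fix t :: real
    have d: "((\<lambda>t. (k * exp (t *\<^sub>R m)) *s v) has_vector_derivative (k * exp (t *\<^sub>R m)) *s (m *s v)) (at t within {0..})"
      for k m :: complex and v :: "complex^'n"
    proof -
      have "bounded_linear (\<lambda>z :: complex. (k * z) *s v)"
        by (intro linear_conv_bounded_linear [THEN iffD1] linearI)
          (simp_all add: vec_eq_iff algebra_simps)
      from bounded_linear.has_vector_derivative [OF this exp_scaleR_has_vector_derivative_right]
      show ?thesis by (simp add: mult.assoc vector_smult_assoc)
    qed
    have cn: "cnj_vec (k *s v) = cnj k *s cnj_vec v" for k and v :: "complex^'n"
      by (simp add: vec_eq_iff cnj_vec_def)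
    \<comment> \<open>The two coefficients are conjugate to each other, so conjugating the
      trajectory exchanges them and the terms regroup into the two eigenvector equations.\<close>
    define p q where "p = c * exp (t *\<^sub>R l)" and "q = cnj c * exp (t *\<^sub>R cnj l)"
    have pq: "cnj p = q" "cnj q = p"
      by (simp_all add: p_def q_def exp_cnj)
    have "bi_apply A (x c t) = p *s (A1 *v a + cnj_mat A2 *v cnj_vec b) + q *s (A1 *v b + cnj_mat A2 *v cnj_vec a)"
      unfolding x_def p_def [symmetric] q_def [symmetric]
      by (simp add: A cnj_vec_add cn pq matrix_vector_right_distrib vector_scalar_commute
          vector_add_ldistrib)
    also have "\<dots> = p *s (l *s a) + q *s (cnj l *s b)" by (simp only: ab ba)
    finally have "bi_apply A (x c t) + bi_apply B 0 = p *s (l *s a) + q *s (cnj l *s b)"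
      by (cases B) (simp add: cnj_vec_def vec_eq_iff matrix_vector_mult_def)
    then show "(x c has_vector_derivative bi_apply A (x c t) + bi_apply B 0) (at t within {0..})"
      using has_vector_derivative_add [OF d [of c l a] d [of "cnj c" "cnj l" b]]
      by (simp only: x_def [abs_def] p_def q_def)
  qed
  obtain d where d: "d > 0" "\<And>x. is_trajectory A B (\<lambda>_. 0) x \<Longrightarrow> norm (x 0) < d \<Longrightarrow> (x \<longlongrightarrow> 0) at_top"
    using stable by (auto simp: asymptotically_stable_def)
  have x_scale: "x (of_real r * c) t = r *\<^sub>R x c t" for r c t
    by (simp add: x_def vec_eq_iff scaleR_conv_of_real [where 'a = complex] algebra_simps)
  have lim: "(x c \<longlongrightarrow> 0) at_top" for c
  proof -
    \<comment> \<open>Attractivity is local, but trajectories may be rescaled by real factors. The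
      summand \<open>1\<close> keeps the denominator positive and makes the rescaled start strictly
      smaller than \<open>d\<close>.\<close>
    define r where "r = d / (norm (x c 0) + 1)"
    have r: "r > 0" "r * norm (x c 0) < d"
      using d(1) by (auto simp: r_def field_simps add_pos_nonneg)
    have "norm (x (of_real r * c) 0) < d" using r by (simp add: x_scale)
    from d(2) [OF traj this] have "((\<lambda>t. inverse r *\<^sub>R (r *\<^sub>R x c t)) \<longlongrightarrow> inverse r *\<^sub>R 0) at_top"
      unfolding x_scale [abs_def] by (intro tendsto_scaleR tendsto_const)
    then show ?thesis using r by simp
  qed
  have vanish: "z = 0" if "((\<lambda>t. exp (t *\<^sub>R m) * z) \<longlongrightarrow> 0) at_top" "Re m \<ge> 0" for z m :: complex
  proof -
    \<comment> \<open>For \<open>Re m \<ge> 0\<close> the exponential has modulus at least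
      \<open>1\<close> on nonnegative times.\<close>
    have "\<forall>\<^sub>F t in at_top. norm z \<le> norm (exp (t *\<^sub>R m) * z)"
      using eventually_ge_at_top [of 0]
      by eventually_elim (use that(2) in \<open>simp add: norm_mult mult_le_cancel_right1\<close>)
    from tendsto_lowerbound [OF tendsto_norm [OF that(1)] this] show ?thesis by simp
  qed
  have lim_nth: "((\<lambda>t. x c t $ j) \<longlongrightarrow> 0) at_top" for c j
    using tendsto_vec_nth [OF lim] by simp
  have "a $ j = 0" for j
  proof (rule vanish [OF _ re])
    have "((\<lambda>t. (x 1 t $ j - \<i> * x \<i> t $ j) / 2) \<longlongrightarrow> (0 - \<i> * 0) / 2) at_top"
      by (intro tendsto_intros lim_nth) simp
    then show "((\<lambda>t. exp (t *\<^sub>R l) * a $ j) \<longlongrightarrow> 0) at_top"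
      by (simp add: x_def algebra_simps)
  qed
  moreover have "b $ j = 0" for j
  proof (rule vanish [of "cnj l"])
    have "((\<lambda>t. (x 1 t $ j + \<i> * x \<i> t $ j) / 2) \<longlongrightarrow> (0 + \<i> * 0) / 2) at_top"
      by (intro tendsto_intros lim_nth) simp
    then show "((\<lambda>t. exp (t *\<^sub>R cnj l) * b $ j) \<longlongrightarrow> 0) at_top"
      by (simp add: x_def algebra_simps)
  qed (use re in simp)
  ultimately have "w $ Inl j = 0" "w $ Inr j = 0" for j
    by (simp_all add: a_def b_def)
  then have "w $ k = 0" for k
    by (cases k) simp_all
  with w(1) show False by (simp add: vec_eq_iff)
qed

text \<open>The exponential of the adjoint is the adjoint of the exponential, and taking adjoints is
  bounded; so the same rate \<open>b\<close> holds and the spectra need not be compared.\<close>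

lemma norm_bi_exp_herm_bound:
  fixes A :: "('n::finite, 'n) bimatrix"
  assumes "\<And>t. t \<ge> 0 \<Longrightarrow> norm (bi_exp (t *\<^sub>R A)) \<le> K * exp (b * t)"
  obtains K' where "\<And>t. t \<ge> 0 \<Longrightarrow> norm (bi_exp (t *\<^sub>R bi_herm A)) \<le> K' * exp (b * t)"
proof -
  obtain H where H: "H \<ge> 0" "\<And>X :: ('n, 'n) bimatrix. norm (bi_herm X) \<le> norm X * H"
    using bounded_linear.nonneg_bounded [OF bounded_linear_bi_herm] by blast
  have "norm (bi_exp (t *\<^sub>R bi_herm A)) \<le> (K * H) * exp (b * t)" if "t \<ge> 0" for t
  proof -
    have "norm (bi_exp (t *\<^sub>R bi_herm A)) = norm (bi_herm (bi_exp (t *\<^sub>R A)))"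
      by (simp add: linear_scale [OF linear_bi_herm] flip: bi_exp_herm)
    also have "\<dots> \<le> norm (bi_exp (t *\<^sub>R A)) * H" by (rule H)
    also have "\<dots> \<le> K * exp (b * t) * H" by (intro mult_right_mono assms that H)
    finally show ?thesis by (simp add: mult_ac)
  qed
  then show ?thesis by (rule that)
qed

lemma Re_eigenvalue_le_spectral_abscissa:
  "l \<in> eigenvalues (lifting A) \<Longrightarrow> Re l \<le> spectral_abscissa A"
  unfolding spectral_abscissa_def by (simp add: finite_eigenvalues)

text \<open>The Sylvester equation carries the sign that integrating \<open>f' = A f + f F\<close>
  produces, namely \<open>A X + X F = - C\<close>. With \<open>A X - X F = C\<close> the claim would
  fail: for scalars \<open>A = F = -1\<close> the left-hand side is always zero. The Lyapunov
  equation has the same form, with the adjoint of \<open>A\<close> on the left and \<open>A\<close>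
  on the right.\<close>

theorem corollary4:
  fixes A1 A2 :: "complex^'n^'n"
    and F1 F2 :: "complex^'p^'p"
    and C1 C2 :: "complex^'p^'n"
    and B1 B2 :: "complex^'m^'n"
    and Q1 Q2 :: "complex^'n^'n"
  shows
    "(spectral_abscissa (A1, A2) + spectral_abscissa (F1, F2) < 0 \<longrightarrow>
        (let sylvester = (\<lambda>X. (A1, A2) **\<^sub>b X + X **\<^sub>b (F1, F2) = - (C1, C2));
             f = (\<lambda>t. bi_exp (t *\<^sub>R (A1, A2)) **\<^sub>b (C1, C2) **\<^sub>b bi_exp (t *\<^sub>R (F1, F2)))
         in f integrable_on {0..} \<and> (\<exists>!X. sylvester X) \<and> sylvester (integral {0..} f)))
     \<and>
     (asymptotically_stable (A1, A2) (B1, B2) \<and> bi_pos_def (Q1, Q2) \<longrightarrow>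
        (let lyapunov = (\<lambda>P. bi_herm (A1, A2) **\<^sub>b P + P **\<^sub>b (A1, A2) = - (Q1, Q2));
             g = (\<lambda>t. bi_exp (t *\<^sub>R bi_herm (A1, A2)) **\<^sub>b (Q1, Q2) **\<^sub>b bi_exp (t *\<^sub>R (A1, A2)))
         in g integrable_on {0..} \<and> (\<exists>!P. lyapunov P) \<and> lyapunov (integral {0..} g)))"
proof -
  define A F C Q where "A = (A1, A2)" and "F = (F1, F2)" and "C = (C1, C2)" and "Q = (Q1, Q2)"
  note defs = A_def F_def C_def Q_def
  \<comment> \<open>A quarter of the spectral gap: raising both rates by \<open>E\<close> puts them
    strictly above the real parts of the eigenvalues, and their sum is still half of the negative
    sum of the abscissas.\<close>
  define E where "E = - (spectral_abscissa A + spectral_abscissa F) / 4"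
  have "(\<lambda>t. bi_exp (t *\<^sub>R A) **\<^sub>b C **\<^sub>b bi_exp (t *\<^sub>R F)) integrable_on {0..} \<and>
      (\<exists>!X. A **\<^sub>b X + X **\<^sub>b F = - C) \<and>
      (let I = integral {0..} (\<lambda>t. bi_exp (t *\<^sub>R A) **\<^sub>b C **\<^sub>b bi_exp (t *\<^sub>R F))
       in A **\<^sub>b I + I **\<^sub>b F = - C)"
    if "spectral_abscissa A + spectral_abscissa F < 0"
  proof -
    have E: "E > 0" using that by (simp add: E_def)
    have "Re l < spectral_abscissa A + E" if "l \<in> eigenvalues (lifting A)" for l
      using Re_eigenvalue_le_spectral_abscissa [OF that] E by linarith
    from bi_exp_bound [OF this] obtain K where
      K: "\<And>t. t \<ge> 0 \<Longrightarrow> norm (bi_exp (t *\<^sub>R A)) \<le> K * exp ((spectral_abscissa A + E) * t)"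
      by blast
    have "Re l < spectral_abscissa F + E" if "l \<in> eigenvalues (lifting F)" for l
      using Re_eigenvalue_le_spectral_abscissa [OF that] E by linarith
    from bi_exp_bound [OF this] obtain L where
      L: "\<And>t. t \<ge> 0 \<Longrightarrow> norm (bi_exp (t *\<^sub>R F)) \<le> L * exp ((spectral_abscissa F + E) * t)"
      by blast
    have "(spectral_abscissa A + E) + (spectral_abscissa F + E) < 0"
      using that by (simp add: E_def field_simps)
    from sylvester_solution [OF K L this, of C] show ?thesis by (simp add: Let_def)
  qed
  moreover have "(\<lambda>t. bi_exp (t *\<^sub>R bi_herm A) **\<^sub>b Q **\<^sub>b bi_exp (t *\<^sub>R A)) integrable_on {0..} \<and>
      (\<exists>!P. bi_herm A **\<^sub>b P + P **\<^sub>b A = - Q) \<and>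
      (let I = integral {0..} (\<lambda>t. bi_exp (t *\<^sub>R bi_herm A) **\<^sub>b Q **\<^sub>b bi_exp (t *\<^sub>R A))
       in bi_herm A **\<^sub>b I + I **\<^sub>b A = - Q)"
    if "asymptotically_stable A (B1, B2)"
  proof -
    \<comment> \<open>Inserting \<open>-1\<close> makes the existence of eigenvalues unnecessary.\<close>
    define m where "m = Max (insert (- 1) (Re ` eigenvalues (lifting A)))"
    have m: "m < 0" "\<And>l. l \<in> eigenvalues (lifting A) \<Longrightarrow> Re l \<le> m"
      using eigenvalues_asymptotically_stable [OF that]
      by (auto simp: m_def finite_eigenvalues)
    \<comment> \<open>As \<open>m\<close> is negative, \<open>m / 2\<close> lies strictly above all
      real parts, and the rates of the two exponentials add up to \<open>m\<close>.\<close>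
    have "Re l < m / 2" if "l \<in> eigenvalues (lifting A)" for l
      using m(2) [OF that] m(1) by linarith
    from bi_exp_bound [OF this] obtain K where
      K: "\<And>t. t \<ge> 0 \<Longrightarrow> norm (bi_exp (t *\<^sub>R A)) \<le> K * exp (m / 2 * t)"
      by blast
    from norm_bi_exp_herm_bound [OF K] obtain L where
      L: "\<And>t. t \<ge> 0 \<Longrightarrow> norm (bi_exp (t *\<^sub>R bi_herm A)) \<le> L * exp (m / 2 * t)"
      by blast
    have "m / 2 + m / 2 < 0" using m by simp
    from sylvester_solution [OF L K this, of Q] show ?thesis by (simp add: Let_def)
  qed
  ultimately show ?thesis
    unfolding Let_def defs by simp
qed

end
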